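(* Let $T>0$ and consider the cascade interconnection $$\dot x_1 = f_1(x_1,t),\qquad \dot x_2 = f_2(x_2,x_1,t),$$ with states $x_1\in\mathbb{R}^{n_1}$, $x_2\in\mathbb{R}^{n_2}$, on the time interval $[0,T)$. Suppose that there exist non-negative functions $V_1(x_1,t)$ and $V_2(x_2,t)$ that are prescribed-time exponentially convergent Lyapunov certificates for the first system and the second system, respectively, and that satisfy, along the system trajectories, $$\dot V_1 \leq -\varphi(t)V_1,\qquad \dot V_2\leq \varphi(t)\,[-aV_2+bV_1],$$ where $\varphi$ is a blow-up function satisfying $\varphi(t)\geq p_0\left(\frac{T}{T-t}\right)^2$ for all $t\in[0,T)$ with $p_0$ a positive constant, and where $a>0$ and $b$ are constants. Then the overall system formed by the cascade interconnection (with state $x=(x_1,x_2)$) is PT-C (prescribed-time convergent).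
   Context: $T>0$ is the prescribed time; the initial time is $0$. The functions $f_1,f_2$ are continuous in their arguments. $\dot V_i$ denotes the time derivative of $V_i(x_i(t),t)$ along trajectories. Blow-up function: $\varphi:[0,T)\to[0,\infty)$ is a blow-up function if it is monotonically increasing on $[0,T)$, continuously differentiable, $\varphi(t)<\infty$ for all $t<T$, $\varphi(t)\ge\varphi_0$ for all $t\in[0,T)$ for some constant $\varphi_0>0$, $\lim_{t\to T}\varphi(t)=\infty$, and $\lim_{t\to T}\int_0^t\varphi(s)\,ds=\infty$. Class $\mathcal K$, $\mathcal L$, $\mathcal{KL}$: a continuous $\alpha:[0,a)\to[0,\infty)$ is class $\mathcal K$ if strictly increasing with $\alpha(0)=0$; a continuous $\beta:[0,\infty)\to[0,\infty)$ is class $\mathcal L$ if monotonically decreasing with $\lim_{s\to\infty}\beta(s)=0$; a class $\mathcal{KL}$ function is class $\mathcal K$ in its first argument and class $\mathcal L$ in its second. PT-C: a system $\dot x=f(x,t)$ is PT-C if, starting from any initial condition $x(0)=x_0$, $|x(t)|\le\beta(|x_0|,\mu(t)-\mu(0))$ holds (for $t\in[0,T)$) with $\beta$ a class $\mathcal{KL}$ function and $\mu$ a blow-up function. Prescribed-time exponentially convergent signal: a signal $q(t)$ such that $|q(t)|\le c\,e^{-\int_{\tilde T}^t\varphi(s)ds}$ for all $t\in(\tilde T,T)$, for some $0\le\tilde T<T$, some constant $c>0$, and some blow-up function $\varphi$ satisfying $\varphi(t)\ge p_0\left(\frac{T}{T-t}\right)^2$ on $(\tilde T,T)$ with a constant $p_0>0$.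 Prescribed-time exponentially convergent Lyapunov certificate: a function $V(x(t),t)$ is such a certificate for a system with state $x$ (possibly with exogenous inputs; here the state of the other system enters as the input) if the fact that $V$ is a prescribed-time exponentially convergent signal implies, based on the form of $V$ and the system dynamics, that $x(t)\to0$ as $t\to T$.
   Formalization: The claim fails as stated, so V_i(·,0) is assumed continuous with V_i(0,0)=0, and each certificate must also give a uniform KL bound on x_i in its state at onset, the signal constant and the input size; only solutions on all of [0,T) are considered. *)

theory Defs
  imports "HOL-Analysis.Analysis"
begin

(* Functions of time are total functions on the reals; only their values on [0,T) are
   constrained, and derivatives are taken within [0,T), so they are one-sided at 0. *)

definition blow_up :: "real \<Rightarrow> (real \<Rightarrow> real) \<Rightarrow> bool" where
  "blow_up T \<phi> \<longleftrightarrow>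
     mono_on {0..<T} \<phi> \<and>
     (\<exists>\<phi>'. continuous_on {0..<T} \<phi>' \<and>
        (\<forall>t\<in>{0..<T}. (\<phi> has_real_derivative \<phi>' t) (at t within {0..<T}))) \<and>
     (\<exists>\<phi>0>0. \<forall>t\<in>{0..<T}. \<phi> t \<ge> \<phi>0) \<and>
     filterlim \<phi> at_top (at_left T) \<and>
     filterlim (\<lambda>t. integral {0..t} \<phi>) at_top (at_left T)"

(* Class K on [0,a) with a = infinity: the estimates below have to make sense for initial
   states of any size. *)
definition class_K :: "(real \<Rightarrow> real) \<Rightarrow> bool" where
  "class_K \<alpha> \<longleftrightarrow> continuous_on {0..} \<alpha> \<and> strict_mono_on {0..} \<alpha> \<and> \<alpha> 0 = 0"

(* "Decreasing" is meant weakly, because beta 0 s = 0 for every s if beta is of class KL. *)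
definition class_L :: "(real \<Rightarrow> real) \<Rightarrow> bool" where
  "class_L \<beta> \<longleftrightarrow> continuous_on {0..} \<beta> \<and> (\<forall>s\<ge>0. \<beta> s \<ge> 0) \<and>
     antimono_on {0..} \<beta> \<and> (\<beta> \<longlongrightarrow> 0) at_top"

definition class_KL :: "(real \<Rightarrow> real \<Rightarrow> real) \<Rightarrow> bool" where
  "class_KL \<beta> \<longleftrightarrow> (\<forall>s\<ge>0. class_K (\<lambda>r. \<beta> r s)) \<and> (\<forall>r\<ge>0. class_L (\<lambda>s. \<beta> r s))"

definition trajectory ::
  "real \<Rightarrow> ('a::real_normed_vector \<Rightarrow> real \<Rightarrow> 'a) \<Rightarrow> (real \<Rightarrow> 'a) \<Rightarrow> bool" where
  "trajectory T f x \<longleftrightarrow>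
     (\<forall>t\<in>{0..<T}. (x has_vector_derivative f (x t) t) (at t within {0..<T}))"

definition pt_convergent ::
  "real \<Rightarrow> ('a::real_normed_vector \<Rightarrow> real \<Rightarrow> 'a) \<Rightarrow> bool" where
  "pt_convergent T f \<longleftrightarrow>
     (\<exists>\<beta> \<mu>. class_KL \<beta> \<and> blow_up T \<mu> \<and>
        (\<forall>x. trajectory T f x \<longrightarrow>
           (\<forall>t\<in>{0..<T}. norm (x t) \<le> \<beta> (norm (x 0)) (\<mu> t - \<mu> 0))))"

definition pt_rate :: "real \<Rightarrow> real \<Rightarrow> (real \<Rightarrow> real) \<Rightarrow> bool" where
  "pt_rate T S \<phi> \<longleftrightarrow> blow_up T \<phi> \<and>
     (\<exists>p0>0. \<forall>t\<in>{S<..<T}. \<phi> t \<ge> p0 * (T / (T - t))\<^sup>2)"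

definition pt_exp_bound ::
  "real \<Rightarrow> real \<Rightarrow> real \<Rightarrow> (real \<Rightarrow> real) \<Rightarrow> (real \<Rightarrow> real) \<Rightarrow> bool" where
  "pt_exp_bound T S c \<phi> q \<longleftrightarrow>
     (\<forall>t\<in>{S<..<T}. \<bar>q t\<bar> \<le> c * exp (- integral {S..t} \<phi>))"

definition pt_exp_signal :: "real \<Rightarrow> (real \<Rightarrow> real) \<Rightarrow> bool" where
  "pt_exp_signal T q \<longleftrightarrow>
     (\<exists>S c \<phi>. 0 \<le> S \<and> S < T \<and> c > 0 \<and> pt_rate T S \<phi> \<and> pt_exp_bound T S c \<phi> q)"

(* Certificate for x' = f(x,u,t) with inputs u from U. First conjunct: along every trajectory
   on which V is a signal, x(t) tends to 0. Second conjunct: this implication comes from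
   V and the dynamics, not from the individual trajectory. For a given signal rate phi
   and onset time S, the convergence therefore obeys a single KL bound, in the size of
   the data: the state at S, the input, and the constant c of the signal V. For instance,
   V = |x|^2 satisfies it for every f, because |x(t)| <= sqrt c * exp (- integral / 2).
   Convergence of each trajectory separately would not give the uniform bound of
   pt_convergent. *)
definition pt_certificate_input ::
  "real \<Rightarrow> ('a::real_normed_vector \<Rightarrow> 'u::real_normed_vector \<Rightarrow> real \<Rightarrow> 'a) \<Rightarrow>
   (real \<Rightarrow> 'u) set \<Rightarrow> ('a \<Rightarrow> real \<Rightarrow> real) \<Rightarrow> bool" where
  "pt_certificate_input T f U V \<longleftrightarrow>
     (\<forall>u\<in>U. \<forall>x. trajectory T (\<lambda>y t. f y (u t) t) x \<longrightarrow>
        pt_exp_signal T (\<lambda>t. V (x t) t) \<longrightarrow> (x \<longlongrightarrow> 0) (at_left T)) \<and>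
     (\<forall>S \<phi>. 0 \<le> S \<longrightarrow> S < T \<longrightarrow> pt_rate T S \<phi> \<longrightarrow>
        (\<exists>\<beta> \<mu>. class_KL \<beta> \<and> blow_up T \<mu> \<and>
           (\<forall>u\<in>U. \<forall>x c m. trajectory T (\<lambda>y t. f y (u t) t) x \<longrightarrow>
              c > 0 \<longrightarrow> pt_exp_bound T S c \<phi> (\<lambda>t. V (x t) t) \<longrightarrow>
              (\<forall>t\<in>{S..<T}. norm (u t) \<le> m) \<longrightarrow>
              (\<forall>t\<in>{S<..<T}. norm (x t) \<le> \<beta> (norm (x S) + m + c) (\<mu> t - \<mu> S)))))"

definition pt_certificate ::
  "real \<Rightarrow> ('a::real_normed_vector \<Rightarrow> real \<Rightarrow> 'a) \<Rightarrow> ('a \<Rightarrow> real \<Rightarrow> real) \<Rightarrow> bool" where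
  "pt_certificate T f V \<longleftrightarrow>
     pt_certificate_input T (\<lambda>x (u::real) t. f x t) {\<lambda>_. 0} V"

definition cascade ::
  "('a \<Rightarrow> real \<Rightarrow> 'a) \<Rightarrow> ('b \<Rightarrow> 'a \<Rightarrow> real \<Rightarrow> 'b) \<Rightarrow> 'a \<times> 'b \<Rightarrow> real \<Rightarrow> 'a \<times> 'b" where
  "cascade f1 f2 x t = (f1 (fst x) t, f2 (snd x) (fst x) t)"

definition deriv_along_le ::
  "real \<Rightarrow> (real \<Rightarrow> real) \<Rightarrow> (real \<Rightarrow> real) \<Rightarrow> bool" where
  "deriv_along_le T v g \<longleftrightarrow>
     (\<forall>t\<in>{0..<T}. \<exists>d. (v has_real_derivative d) (at t within {0..<T}) \<and> d \<le> g t)"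

end

theory Submission
  imports Defs
begin

text \<open>With \<open>k = 2\<bar>b\<bar> + 1\<close> and \<open>l = min a (1/2)\<close>, the function \<open>W = V2 + k V1\<close> satisfies
  \<open>W' \<le> - l \<phi> W\<close>, so that \<open>V1\<close> and \<open>V2\<close> are both signals of rate \<open>l \<phi>\<close> with constant \<open>W(0)\<close>.
  As \<open>V1\<close> and \<open>V2\<close> are continuous and vanish at the origin at time 0, \<open>W(0)\<close> is at most a class K
  function of the initial state. The first certificate then bounds \<open>x1\<close>, this bound is the input
  bound needed by the second certificate, and the two KL estimates are added after rewriting
  their time scales in terms of \<open>1 / (T - t)\<close>.\<close>

section \<open>Comparison functions of class K, L and KL\<close>

lemma class_K_mono: "class_K \<alpha> \<Longrightarrow> 0 \<le> r \<Longrightarrow> r \<le> s \<Longrightarrow> \<alpha> r \<le> \<alpha> s"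
  unfolding class_K_def using strict_mono_on_leD[of "{0..}" \<alpha> r s] by auto

lemma class_K_nonneg: "class_K \<alpha> \<Longrightarrow> 0 \<le> r \<Longrightarrow> 0 \<le> \<alpha> r"
  using class_K_mono[of \<alpha> 0 r] by (simp add: class_K_def)

lemma class_K_ident: "class_K (\<lambda>r. r)"
  by (auto simp: class_K_def strict_mono_on_def)

lemma class_K_add:
  assumes "class_K \<alpha>" "class_K \<gamma>"
  shows "class_K (\<lambda>r. \<alpha> r + \<gamma> r)"
  using assms unfolding class_K_def strict_mono_on_def
  by (auto intro!: continuous_on_add add_strict_mono)

lemma class_K_scale:
  assumes "class_K \<alpha>" "k > 0"
  shows "class_K (\<lambda>r. k * \<alpha> r)"
  using assms unfolding class_K_def strict_mono_on_def
  by (auto intro!: continuous_on_mult_left)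

lemma class_K_compose:
  assumes "class_K \<alpha>" "class_K \<gamma>"
  shows "class_K (\<lambda>r. \<alpha> (\<gamma> r))"
proof -
  have "continuous_on {0..} (\<lambda>r. \<alpha> (\<gamma> r))"
    by (rule continuous_on_compose2[of "{0..}" \<alpha>])
       (use assms class_K_nonneg[OF assms(2)] in \<open>auto simp: class_K_def\<close>)
  then show ?thesis
    using assms class_K_nonneg[OF assms(2)] unfolding class_K_def strict_mono_on_def by auto
qed

lemma class_L_add:
  assumes "class_L \<alpha>" "class_L \<gamma>"
  shows "class_L (\<lambda>s. \<alpha> s + \<gamma> s)"
  using assms unfolding class_L_def monotone_on_def
  by (auto intro!: continuous_on_add add_mono tendsto_add_zero)

lemma class_KL_add:
  assumes "class_KL \<beta>" "class_KL \<gamma>"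
  shows "class_KL (\<lambda>r s. \<beta> r s + \<gamma> r s)"
  using assms unfolding class_KL_def by (auto intro: class_K_add class_L_add)

text \<open>Serves as a summand of the final estimate. A certificate bounds the state only strictly
  after the onset time, and at \<open>s = 0\<close> this function equals \<open>r\<close>, which
  covers the initial instant.\<close>

lemma class_KL_exp: "class_KL (\<lambda>r s. r * exp (- s))"
proof -
  have "class_K (\<lambda>r. r * exp (- s))" for s :: real
    using class_K_scale[OF class_K_ident, of "exp (- s)"] by (simp add: mult.commute)
  moreover have "class_L (\<lambda>s. r * exp (- s))" if "r \<ge> 0" for r :: real
  proof -
    have "((\<lambda>s::real. exp (- s)) \<longlongrightarrow> 0) at_top"
      by (rule filterlim_compose[OF exp_at_bot filterlim_uminus_at_bot_at_top])
    then have "((\<lambda>s. r * exp (- s)) \<longlongrightarrow> 0) at_top"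
      by (rule tendsto_mult_right_zero)
    then show ?thesis
      using that by (auto simp: class_L_def monotone_on_def mult_left_mono intro!: continuous_intros)
  qed
  ultimately show ?thesis by (simp add: class_KL_def)
qed

text \<open>Continuity in the first argument lets \<epsilon> tend to 0 from the right. This side is
  the relevant one because \<open>r + \<epsilon>\<close> stays in the domain even for
  \<open>r = 0\<close>.\<close>

lemma class_KL_le_limit:
  assumes "class_KL \<beta>" "s \<ge> 0" "r \<ge> 0" and le: "\<And>\<epsilon>. \<epsilon> > 0 \<Longrightarrow> y \<le> \<beta> (r + \<epsilon>) s"
  shows "y \<le> \<beta> r s"
proof -
  have cont: "continuous_on {0..} (\<lambda>r. \<beta> r s)"
    using assms by (simp add: class_KL_def class_K_def)
  have "((\<lambda>\<epsilon>. r + \<epsilon>) \<longlongrightarrow> r + 0) (at_right 0)"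
    by (intro tendsto_intros)
  then have "((\<lambda>\<epsilon>. \<beta> (r + \<epsilon>) s) \<longlongrightarrow> \<beta> r s) (at_right 0)"
    using assms(3) by (intro continuous_on_tendsto_compose[OF cont])
      (auto intro!: eventually_at_rightI[of 0 1])
  then show ?thesis
    by (rule tendsto_lowerbound) (auto intro!: eventually_at_rightI[of 0 1] le)
qed

text \<open>The maximum of \<open>V\<close> over the ball of radius \<open>r\<close> is continuous
  and nondecreasing in \<open>r\<close> and vanishes at 0; adding \<open>r\<close> makes it strictly
  increasing. It turns the initial value of a certificate into a function of the size of the initial
  state.\<close>

lemma class_K_majorant:
  fixes V :: "'a::euclidean_space \<Rightarrow> real"
  assumes cont: "continuous_on UNIV V" and "V 0 = 0"
  shows "\<exists>\<alpha>. class_K \<alpha> \<and> (\<forall>x. V x \<le> \<alpha> (norm x))"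
proof -
  \<comment> \<open>Scaling a fixed unit ball keeps the index set of the supremum independent of
    \<open>r\<close>, so that \<open>M r\<close> and \<open>M s\<close> can be compared point by
    point.\<close>
  define M where "M r = (SUP y\<in>cball 0 1. V (r *\<^sub>R y))" for r
  have bdd: "bdd_above ((\<lambda>y. V (r *\<^sub>R y)) ` cball 0 1)" for r
    by (intro bounded_imp_bdd_above compact_imp_bounded compact_continuous_image
        continuous_on_compose2[OF cont] continuous_intros) auto
  have upper: "V (r *\<^sub>R y) \<le> M r" if "norm y \<le> 1" for r y
    unfolding M_def by (rule cSUP_upper[OF _ bdd]) (use that in auto)
  have least: "M r \<le> z" if "\<And>y. norm y \<le> 1 \<Longrightarrow> V (r *\<^sub>R y) \<le> z" for r z
    unfolding M_def by (rule cSUP_least) (use that in auto)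
  have M0: "M 0 = 0"
    by (simp add: M_def assms)
  have mono: "M r \<le> M s" if "0 \<le> r" "r \<le> s" for r s
  proof (cases "s = 0")
    case False
    show ?thesis
    proof (rule least)
      fix y :: 'a assume "norm y \<le> 1"
      \<comment> \<open>Every point of the smaller ball is also \<open>s\<close> times a point of
        the unit ball.\<close>
      then have "norm ((r / s) *\<^sub>R y) \<le> 1"
        using that False mult_mono[of r s "norm y" 1] by (simp add: divide_le_eq)
      from upper[OF this, of s] show "V (r *\<^sub>R y) \<le> M s"
        using False by simp
    qed
  qed (use that in auto)
  have "continuous_on {0..} M"
    unfolding continuous_on_iff
  proof (intro ballI allI impI)
    fix r e :: real assume r: "r \<in> {0..}" and e: "e > 0"
    \<comment> \<open>For \<open>dist s r < 1\<close> both scaled points lie in the ball of radius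
      \<open>r + 1\<close>, hence the \<open>min d 1\<close> below. Passing to suprema keeps only a
      weak inequality, hence the tolerance \<open>e / 2\<close>.\<close>
    have "uniformly_continuous_on (cball 0 (r + 1)) V"
      by (rule compact_uniformly_continuous[OF continuous_on_subset[OF cont]]) auto
    then obtain d where d: "d > 0"
      "\<And>x y. x \<in> cball 0 (r + 1) \<Longrightarrow> y \<in> cball 0 (r + 1) \<Longrightarrow> dist y x < d \<Longrightarrow> dist (V y) (V x) < e / 2"
      using e unfolding uniformly_continuous_on_def by (metis half_gt_zero)
    show "\<exists>d>0. \<forall>s\<in>{0..}. dist s r < d \<longrightarrow> dist (M s) (M r) < e"
    proof (intro exI[of _ "min d 1"] conjI ballI impI)
      fix s assume s: "s \<in> {0..}" "dist s r < min d 1"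
      have close: "\<bar>V (s *\<^sub>R y) - V (r *\<^sub>R y)\<bar> < e / 2" if y: "norm y \<le> 1" for y
      proof -
        have "norm (s *\<^sub>R y) \<le> r + 1" "norm (r *\<^sub>R y) \<le> r + 1"
          using r s y mult_left_le[of "norm y" s] mult_left_le[of "norm y" r]
          by (auto simp: dist_real_def)
        moreover have "dist (s *\<^sub>R y) (r *\<^sub>R y) < d"
          using s y mult_left_le[of "norm y" "\<bar>s - r\<bar>"]
          by (auto simp: dist_norm simp flip: scaleR_diff_left)
        ultimately show ?thesis
          using d(2)[of "r *\<^sub>R y" "s *\<^sub>R y"] by (simp add: dist_real_def)
      qed
      have "M s \<le> M r + e / 2"
      proof (rule least)
        fix y :: 'a assume "norm y \<le> 1"
        then show "V (s *\<^sub>R y) \<le> M r + e / 2"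
          using close[of y] upper[of y r] by linarith
      qed
      moreover have "M r \<le> M s + e / 2"
      proof (rule least)
        fix y :: 'a assume "norm y \<le> 1"
        then show "V (r *\<^sub>R y) \<le> M s + e / 2"
          using close[of y] upper[of y s] by linarith
      qed
      ultimately show "dist (M s) (M r) < e"
        using e by (simp add: dist_real_def)
    qed (use d in auto)
  qed
  then have "class_K (\<lambda>r. M r + r)"
    using M0 mono by (auto simp: class_K_def strict_mono_on_def intro!: continuous_intros add_le_less_mono)
  \<comment> \<open>A nonzero \<open>x\<close> is \<open>norm x\<close> times the unit vector
    \<open>sgn x\<close>.\<close>
  moreover have "V x \<le> M (norm x) + norm x" for x
    using upper[of "sgn x" "norm x"] by (cases "x = 0") (auto simp: sgn_div_norm M0 assms intro: add_increasing2)
  ultimately show ?thesis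
    by blast
qed

section \<open>Blow-up functions and changes of time scale\<close>

lemma blow_up_continuous: "blow_up T \<mu> \<Longrightarrow> continuous_on {0..<T} \<mu>"
  unfolding blow_up_def by (auto simp: continuous_on_eq_continuous_within intro: DERIV_continuous)

lemma blow_up_mono: "blow_up T \<mu> \<Longrightarrow> 0 \<le> s \<Longrightarrow> s \<le> t \<Longrightarrow> t < T \<Longrightarrow> \<mu> s \<le> \<mu> t"
  unfolding blow_up_def by (auto dest: mono_onD[of _ _ s t])

lemma blow_up_scale:
  assumes "blow_up T \<mu>" "k > 0"
  shows "blow_up T (\<lambda>t. k * \<mu> t)"
proof -
  obtain \<mu>' \<mu>0 where "continuous_on {0..<T} \<mu>'"
      "\<forall>t\<in>{0..<T}. (\<mu> has_real_derivative \<mu>' t) (at t within {0..<T})"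
      "\<mu>0 > 0" "\<forall>t\<in>{0..<T}. \<mu> t \<ge> \<mu>0"
    using assms unfolding blow_up_def by blast
  then have "continuous_on {0..<T} (\<lambda>t. k * \<mu>' t)"
      "\<forall>t\<in>{0..<T}. ((\<lambda>t. k * \<mu> t) has_real_derivative k * \<mu>' t) (at t within {0..<T})"
      "k * \<mu>0 > 0" "\<forall>t\<in>{0..<T}. k * \<mu> t \<ge> k * \<mu>0"
    using assms by (auto intro: continuous_on_mult_left DERIV_cmult)
  moreover have "filterlim (\<lambda>t. k * \<mu> t) at_top (at_left T)"
      "filterlim (\<lambda>t. k * integral {0..t} \<mu>) at_top (at_left T)"
    using assms by (auto simp: blow_up_def intro!: filterlim_tendsto_pos_mult_at_top[OF tendsto_const])
  moreover have "mono_on {0..<T} (\<lambda>t. k * \<mu> t)"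
    using assms by (auto simp: blow_up_def mono_on_def)
  ultimately show ?thesis
    unfolding blow_up_def integral_mult_right by blast
qed

text \<open>The common time scale of the final estimate. Its integral is
  \<open>ln T - ln (T - t)\<close>, which still diverges at \<open>T\<close>.\<close>

lemma blow_up_inverse:
  assumes "T > 0"
  shows "blow_up T (\<lambda>t. 1 / (T - t))"
proof -
  have to0: "filterlim (\<lambda>t. T - t) (at_right 0) (at_left T)"
    unfolding filterlim_at
    by (auto intro!: tendsto_eq_intros eventually_at_leftI[of "T - 1"])
  then have "filterlim (\<lambda>t. inverse (T - t)) at_top (at_left T)"
    by (rule filterlim_compose[OF filterlim_inverse_at_top_right])
  then have 1: "filterlim (\<lambda>t. 1 / (T - t)) at_top (at_left T)"
    by (simp add: inverse_eq_divide)
  have "filterlim (\<lambda>t. - ln (T - t)) at_top (at_left T)"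
    using filterlim_compose[OF ln_at_0 to0] by (simp add: filterlim_uminus_at_bot)
  then have lim: "filterlim (\<lambda>t. ln T + - ln (T - t)) at_top (at_left T)"
    by (rule filterlim_tendsto_add_at_top[OF tendsto_const])
  have int: "integral {0..t} (\<lambda>t. 1 / (T - t)) = ln T + - ln (T - t)" if "0 < t" "t < T" for t
  proof (rule integral_unique)
    have "((\<lambda>t. - ln (T - t)) has_vector_derivative 1 / (T - s)) (at s within {0..t})"
      if "s \<in> {0..t}" for s
      using that \<open>t < T\<close>
      by (auto intro!: derivative_eq_intros simp: has_real_derivative_iff_has_vector_derivative[symmetric])
    then have "((\<lambda>t. 1 / (T - t)) has_integral - ln (T - t) - - ln (T - 0)) {0..t}"
      using that by (intro fundamental_theorem_of_calculus) auto
    then show "((\<lambda>t. 1 / (T - t)) has_integral ln T + - ln (T - t)) {0..t}"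
      by simp
  qed
  have 2: "filterlim (\<lambda>t. integral {0..t} (\<lambda>t. 1 / (T - t))) at_top (at_left T)"
    by (rule filterlim_cong[THEN iffD1, OF refl refl _ lim])
       (use assms int in \<open>auto intro!: eventually_at_leftI[of 0]\<close>)
  have "continuous_on {0..<T} (\<lambda>t. 1 / (T - t)\<^sup>2)"
    by (auto intro!: continuous_intros)
  moreover have "((\<lambda>t. 1 / (T - t)) has_real_derivative 1 / (T - t)\<^sup>2) (at t within {0..<T})"
    if "t \<in> {0..<T}" for t
    using that by (auto intro!: derivative_eq_intros simp: power2_eq_square)
  moreover have "1 / T > 0" "\<And>t. t \<in> {0..<T} \<Longrightarrow> 1 / (T - t) \<ge> 1 / T"
    using assms by (auto intro!: divide_left_mono)
  moreover have "mono_on {0..<T} (\<lambda>t. 1 / (T - t))"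
    by (auto simp: mono_on_def intro!: divide_left_mono)
  ultimately show ?thesis
    unfolding blow_up_def using 1 2 by blast
qed

text \<open>The substitution \<open>t = T - 1 / (s + 1 / T)\<close> inverts \<open>s = 1 / (T - t) - 1 / T\<close>: it
  expresses any blow-up scale in terms of the scale \<open>1 / (T - t)\<close>.\<close>

lemma class_KL_rescale:
  assumes \<beta>: "class_KL \<beta>" and \<mu>: "blow_up T \<mu>" and \<gamma>: "class_K \<gamma>" and "T > 0"
  shows "class_KL (\<lambda>r s. \<beta> (\<gamma> r) (\<mu> (T - 1 / (s + 1 / T)) - \<mu> 0))"
proof -
  define \<tau> where "\<tau> s = T - 1 / (s + 1 / T)" for s
  define \<sigma> where "\<sigma> s = \<mu> (\<tau> s) - \<mu> 0" for s
  have pos: "s + 1 / T > 0" if "s \<ge> 0" for s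
    using that \<open>T > 0\<close> by (simp add: add_nonneg_pos)
  have \<tau>: "\<tau> s \<in> {0..<T}" if "s \<ge> 0" for s
  proof -
    have "1 / (s + 1 / T) \<le> 1 / (1 / T)"
      using that \<open>T > 0\<close> pos[OF that] by (intro divide_left_mono) auto
    then show ?thesis using pos[OF that] by (simp add: \<tau>_def)
  qed
  have \<tau>_mono: "\<tau> r \<le> \<tau> s" if "0 \<le> r" "r \<le> s" for r s
    unfolding \<tau>_def using that pos[of r] pos[of s] by (intro diff_left_mono divide_left_mono) auto
  have \<sigma>_mono: "\<sigma> r \<le> \<sigma> s" if "0 \<le> r" "r \<le> s" for r s
    unfolding \<sigma>_def using blow_up_mono[OF \<mu>] \<tau> \<tau>_mono that by simp
  have \<sigma>_nonneg: "\<sigma> s \<ge> 0" if "s \<ge> 0" for s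
    unfolding \<sigma>_def using blow_up_mono[OF \<mu>, of 0 "\<tau> s"] \<tau>[OF that] by simp
  have "continuous_on {0..} \<tau>"
    unfolding \<tau>_def using pos by (force intro!: continuous_intros)
  then have "continuous_on {0..} (\<lambda>s. \<mu> (\<tau> s))"
    by (rule continuous_on_compose2[OF blow_up_continuous[OF \<mu>]])
       (rule image_subsetI, rule \<tau>, simp)
  then have \<sigma>_cont: "continuous_on {0..} \<sigma>"
    unfolding \<sigma>_def by (intro continuous_intros)
  have "filterlim (\<lambda>s. s + 1 / T) at_top at_top"
    by (subst add.commute) (rule filterlim_tendsto_add_at_top[OF tendsto_const filterlim_ident])
  then have "((\<lambda>s. 1 / (s + 1 / T)) \<longlongrightarrow> 0) at_top"
    by (intro real_tendsto_divide_at_top[OF tendsto_const])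
  \<comment> \<open>As \<tau> tends to \<open>T\<close> while staying strictly below it, the
    divergence of \<mu> at \<open>T\<close> from the left carries over to \<sigma> at infinity. This
    yields the class L limit.\<close>
  from tendsto_diff[OF tendsto_const[of T] this] have "(\<tau> \<longlongrightarrow> T) at_top"
    by (simp add: \<tau>_def[abs_def])
  moreover have "eventually (\<lambda>s. \<tau> s \<in> {..<T} \<and> \<tau> s \<noteq> T) at_top"
    using eventually_ge_at_top[of 0] by eventually_elim (use \<tau> in force)
  ultimately have "filterlim \<tau> (at_left T) at_top"
    by (simp add: filterlim_at)
  then have "filterlim (\<lambda>s. \<mu> (\<tau> s)) at_top at_top"
    using \<mu> by (auto simp: blow_up_def intro: filterlim_compose)
  then have \<sigma>_lim: "filterlim \<sigma> at_top at_top"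
    unfolding \<sigma>_def using filterlim_tendsto_add_at_top[OF tendsto_const[of "- \<mu> 0"]]
    by (simp add: add.commute)
  have "class_K (\<lambda>r. \<beta> (\<gamma> r) (\<sigma> s))" if "s \<ge> 0" for s
    using \<beta> \<sigma>_nonneg[OF that] by (intro class_K_compose[OF _ \<gamma>]) (simp add: class_KL_def)
  moreover have "class_L (\<lambda>s. \<beta> (\<gamma> r) (\<sigma> s))" if "r \<ge> 0" for r
  proof -
    have L: "class_L (\<lambda>s. \<beta> (\<gamma> r) s)"
      using \<beta> class_K_nonneg[OF \<gamma> that] by (simp add: class_KL_def)
    have "continuous_on {0..} (\<lambda>s. \<beta> (\<gamma> r) (\<sigma> s))"
      by (rule continuous_on_compose2[OF _ \<sigma>_cont]) (use L \<sigma>_nonneg in \<open>auto simp: class_L_def\<close>)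
    moreover have "((\<lambda>s. \<beta> (\<gamma> r) (\<sigma> s)) \<longlongrightarrow> 0) at_top"
      by (rule filterlim_compose[OF _ \<sigma>_lim]) (use L in \<open>auto simp: class_L_def\<close>)
    ultimately show ?thesis
      using L \<sigma>_nonneg \<sigma>_mono by (auto simp: class_L_def monotone_on_def)
  qed
  ultimately show ?thesis
    by (simp add: class_KL_def \<sigma>_def \<tau>_def)
qed

section \<open>Decay along trajectories and bounds from certificates\<close>

text \<open>The integrating factor \<open>exp (integral {0..s} \<phi>)\<close> turns the inequality
  into a nonpositive derivative. The mean value theorem then suffices, so the derivative of
  \<open>v\<close> may be discontinuous.\<close>

lemma deriv_along_decay:
  assumes v: "deriv_along_le T v (\<lambda>t. - \<phi> t * v t)" and cont: "continuous_on {0..<T} \<phi>"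
    and t: "0 \<le> t" "t < T"
  shows "v t \<le> v 0 * exp (- integral {0..t} \<phi>)"
proof (cases "t = 0")
  case False
  define w where "w s = v s * exp (integral {0..s} \<phi>)" for s
  obtain v' where v': "\<And>s. s \<in> {0..<T} \<Longrightarrow> (v has_real_derivative v' s) (at s within {0..<T})"
    "\<And>s. s \<in> {0..<T} \<Longrightarrow> v' s \<le> - \<phi> s * v s"
    using v unfolding deriv_along_le_def by metis
  define w' where "w' s = (v' s + \<phi> s * v s) * exp (integral {0..s} \<phi>)" for s
  have "(w has_real_derivative w' s) (at s within {0..t})" if "s \<in> {0..t}" for s
  proof -
    have "(v has_real_derivative v' s) (at s within {0..t})"
      by (rule DERIV_subset[OF v'(1)]) (use that t in auto)
    moreover have "((\<lambda>s. integral {0..s} \<phi>) has_real_derivative \<phi> s) (at s within {0..t})"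
      using that t by (intro integral_has_real_derivative continuous_on_subset[OF cont]) auto
    ultimately show ?thesis
      unfolding w_def w'_def by (auto intro!: derivative_eq_intros simp: algebra_simps)
  qed
  then have "\<exists>s\<in>{0<..<t}. w t - w 0 = w' s * (t - 0)"
    using t False by (intro mvt_simple) (auto simp: has_field_derivative_def)
  then obtain s where s: "s \<in> {0<..<t}" "w t - w 0 = w' s * (t - 0)" ..
  have "v' s + \<phi> s * v s \<le> 0"
    using v'(2)[of s] s t by simp
  then have "w' s \<le> 0"
    by (simp add: w'_def mult_nonpos_nonneg)
  then have "w t \<le> w 0"
    using s t mult_nonpos_nonneg[of "w' s" t] by simp
  then show ?thesis
    by (simp add: w_def exp_minus field_simps)
qed simp

text \<open>The definition asks for \<open>c > 0\<close>; the case \<open>c = 0\<close>, which the zero initial state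
  produces, is a limit.\<close>

lemma pt_certificate_input_bound:
  assumes "pt_certificate_input T f U V" "0 \<le> S" "S < T" "pt_rate T S \<phi>"
  obtains \<beta> \<mu> where "class_KL \<beta>" "blow_up T \<mu>"
    "\<And>u x c m t. u \<in> U \<Longrightarrow> trajectory T (\<lambda>y t. f y (u t) t) x \<Longrightarrow> c \<ge> 0 \<Longrightarrow>
       pt_exp_bound T S c \<phi> (\<lambda>t. V (x t) t) \<Longrightarrow> (\<And>t. t \<in> {S..<T} \<Longrightarrow> norm (u t) \<le> m) \<Longrightarrow>
       t \<in> {S<..<T} \<Longrightarrow> norm (x t) \<le> \<beta> (norm (x S) + m + c) (\<mu> t - \<mu> S)"
proof -
  obtain \<beta> \<mu> where \<beta>: "class_KL \<beta>" and \<mu>: "blow_up T \<mu>"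
    and bound: "\<forall>u\<in>U. \<forall>x c m. trajectory T (\<lambda>y t. f y (u t) t) x \<longrightarrow> c > 0 \<longrightarrow>
       pt_exp_bound T S c \<phi> (\<lambda>t. V (x t) t) \<longrightarrow> (\<forall>t\<in>{S..<T}. norm (u t) \<le> m) \<longrightarrow>
       (\<forall>t\<in>{S<..<T}. norm (x t) \<le> \<beta> (norm (x S) + m + c) (\<mu> t - \<mu> S))"
    using assms(1)[unfolded pt_certificate_input_def, THEN conjunct2, rule_format, OF assms(2-4)]
    by (elim exE conjE)
  show thesis
  proof (rule that[OF \<beta> \<mu>])
    fix u x c m t
    assume u: "u \<in> U" and x: "trajectory T (\<lambda>y t. f y (u t) t) x" and c: "c \<ge> 0"
      and V: "pt_exp_bound T S c \<phi> (\<lambda>t. V (x t) t)"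
      and m: "\<And>t. t \<in> {S..<T} \<Longrightarrow> norm (u t) \<le> m" and t: "t \<in> {S<..<T}"
    \<comment> \<open>The input bound includes the instant \<open>S\<close> itself, where a norm is
      at most \<open>m\<close>.\<close>
    have "0 \<le> m"
      using m[of S] \<open>S < T\<close> norm_ge_zero[of "u S"] by (meson atLeastLessThan_iff order_refl order_trans)
    show "norm (x t) \<le> \<beta> (norm (x S) + m + c) (\<mu> t - \<mu> S)"
    proof (rule class_KL_le_limit[OF \<beta>])
      show "0 \<le> \<mu> t - \<mu> S"
        using blow_up_mono[OF \<mu>, of S t] t \<open>0 \<le> S\<close> by simp
      show "0 \<le> norm (x S) + m + c"
        using c \<open>0 \<le> m\<close> by simp
      fix \<epsilon> :: real assume "\<epsilon> > 0"
      have "pt_exp_bound T S (c + \<epsilon>) \<phi> (\<lambda>t. V (x t) t)"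
        using V \<open>\<epsilon> > 0\<close> unfolding pt_exp_bound_def
        by (smt (verit, best) exp_ge_zero mult_right_mono)
      moreover have "c + \<epsilon> > 0" "\<forall>t\<in>{S..<T}. norm (u t) \<le> m"
        using c \<open>\<epsilon> > 0\<close> m by auto
      ultimately have "norm (x t) \<le> \<beta> (norm (x S) + m + (c + \<epsilon>)) (\<mu> t - \<mu> S)"
        using bound u x t by blast
      then show "norm (x t) \<le> \<beta> (norm (x S) + m + c + \<epsilon>) (\<mu> t - \<mu> S)"
        by (simp add: add.assoc)
    qed
  qed
qed

text \<open>A system without input is encoded with the zero input, for which \<open>m = 0\<close> is
  a valid bound.\<close>

lemma pt_certificate_bound:
  assumes "pt_certificate T f V" "0 \<le> S" "S < T" "pt_rate T S \<phi>"
  obtains \<beta> \<mu> where "class_KL \<beta>" "blow_up T \<mu>"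
    "\<And>x c t. trajectory T f x \<Longrightarrow> c \<ge> 0 \<Longrightarrow> pt_exp_bound T S c \<phi> (\<lambda>t. V (x t) t) \<Longrightarrow>
       t \<in> {S<..<T} \<Longrightarrow> norm (x t) \<le> \<beta> (norm (x S) + c) (\<mu> t - \<mu> S)"
proof (rule pt_certificate_input_bound[OF assms(1)[unfolded pt_certificate_def] assms(2-4)], goal_cases)
  case (1 \<beta> \<mu>)
  show thesis
  proof (rule that[OF 1(2,3)])
    fix x c t
    assume "trajectory T f x" "c \<ge> 0" "pt_exp_bound T S c \<phi> (\<lambda>t. V (x t) t)" "t \<in> {S<..<T}"
    then show "norm (x t) \<le> \<beta> (norm (x S) + c) (\<mu> t - \<mu> S)"
      using 1(4)[of "\<lambda>_. 0" x c 0 t] by simp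
  qed
qed

lemma trajectory_cascade:
  assumes "trajectory T (cascade f1 f2) x"
  shows "trajectory T f1 (\<lambda>t. fst (x t))"
    and "trajectory T (\<lambda>y t. f2 y (fst (x t)) t) (\<lambda>t. snd (x t))"
proof -
  have "(x has_vector_derivative (f1 (fst (x t)) t, f2 (snd (x t)) (fst (x t)) t)) (at t within {0..<T})"
    if "t \<in> {0..<T}" for t
    using assms that by (simp add: trajectory_def cascade_def)
  from bounded_linear.has_vector_derivative[OF bounded_linear_fst this]
    bounded_linear.has_vector_derivative[OF bounded_linear_snd this]
  show "trajectory T f1 (\<lambda>t. fst (x t))"
    and "trajectory T (\<lambda>y t. f2 y (fst (x t)) t) (\<lambda>t. snd (x t))"
    by (simp_all add: trajectory_def)
qed

section \<open>The cascade estimate\<close>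

theorem theorem1:
  fixes T a b p0 :: real
    and f1 :: "real ^ 'n1 \<Rightarrow> real \<Rightarrow> real ^ 'n1"
    and f2 :: "real ^ 'n2 \<Rightarrow> real ^ 'n1 \<Rightarrow> real \<Rightarrow> real ^ 'n2"
    and V1 :: "real ^ 'n1 \<Rightarrow> real \<Rightarrow> real"
    and V2 :: "real ^ 'n2 \<Rightarrow> real \<Rightarrow> real"
    and \<phi> :: "real \<Rightarrow> real"
  assumes "T > 0"
    and "continuous_on (UNIV \<times> {0..<T}) (\<lambda>(x1, t). f1 x1 t)"
    and "continuous_on (UNIV \<times> UNIV \<times> {0..<T}) (\<lambda>(x2, x1, t). f2 x2 x1 t)"
    and "\<And>x1 t. t \<in> {0..<T} \<Longrightarrow> V1 x1 t \<ge> 0"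
    and "\<And>x2 t. t \<in> {0..<T} \<Longrightarrow> V2 x2 t \<ge> 0"
    and "continuous_on UNIV (\<lambda>x1. V1 x1 0)" and "V1 0 0 = 0"
    and "continuous_on UNIV (\<lambda>x2. V2 x2 0)" and "V2 0 0 = 0"
    and "pt_certificate T f1 V1"
    and "pt_certificate_input T f2 {x1. trajectory T f1 x1} V2"
    and "blow_up T \<phi>"
    and "p0 > 0" and "\<And>t. t \<in> {0..<T} \<Longrightarrow> \<phi> t \<ge> p0 * (T / (T - t))\<^sup>2"
    and "a > 0"
    and "\<And>x. trajectory T (cascade f1 f2) x \<Longrightarrow>
           deriv_along_le T (\<lambda>t. V1 (fst (x t)) t) (\<lambda>t. - \<phi> t * V1 (fst (x t)) t)"
    and "\<And>x. trajectory T (cascade f1 f2) x \<Longrightarrow>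
           deriv_along_le T (\<lambda>t. V2 (snd (x t)) t)
             (\<lambda>t. \<phi> t * (- a * V2 (snd (x t)) t + b * V1 (fst (x t)) t))"
  shows "pt_convergent T (cascade f1 f2)"
proof -
  \<comment> \<open>For nonnegative \<open>V1\<close> and \<open>V2\<close>, the decay of
    \<open>W\<close> at rate \<open>l * \<phi>\<close> needs \<open>l \<le> a\<close> and
    \<open>b + l * k \<le> k\<close>. The second holds since \<open>b\<close> and
    \<open>l * k\<close> are each at most \<open>k / 2\<close>. The summand 1 in \<open>k\<close>
    gives \<open>k \<ge> 1\<close>, so that \<open>V1\<close> is at most \<open>W\<close>.\<close>
  define l where "l = min a (1 / 2)"
  define k where "k = 2 * \<bar>b\<bar> + 1"
  have l: "l > 0" "l \<le> a" "l \<le> 1 / 2"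
    using \<open>a > 0\<close> by (auto simp: l_def)
  have "k \<ge> 1" "2 * b \<le> k"
    by (auto simp: k_def)
  moreover from this l have "l * k \<le> 1 / 2 * k"
    by (intro mult_right_mono) auto
  ultimately have k: "k \<ge> 1" "b + l * k \<le> k"
    by linarith+
  note \<phi> = \<open>blow_up T \<phi>\<close>
  have \<phi>_pos: "\<phi> t \<ge> 0" if "t \<in> {0..<T}" for t
    using \<phi> that unfolding blow_up_def by (meson less_imp_le order_trans)
  \<comment> \<open>The slower rate is still admissible for the certificates, from onset time 0 and
    with \<open>l * p0\<close> in place of \<open>p0\<close>.\<close>
  have rate: "pt_rate T 0 (\<lambda>t. l * \<phi> t)"
    unfolding pt_rate_def
  proof (intro conjI exI[of _ "l * p0"] ballI)
    show "blow_up T (\<lambda>t. l * \<phi> t)" by (rule blow_up_scale[OF \<phi> l(1)])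
    show "l * p0 * (T / (T - t))\<^sup>2 \<le> l * \<phi> t" if "t \<in> {0<..<T}" for t
      using mult_left_mono[OF assms(14)[of t]] that l by (simp add: mult.assoc)
  qed (use l \<open>p0 > 0\<close> in simp)

  obtain \<beta>1 \<mu>1 where \<beta>1: "class_KL \<beta>1" and \<mu>1: "blow_up T \<mu>1"
    and bound1: "\<And>x c t. trajectory T f1 x \<Longrightarrow> c \<ge> 0 \<Longrightarrow>
       pt_exp_bound T 0 c (\<lambda>t. l * \<phi> t) (\<lambda>t. V1 (x t) t) \<Longrightarrow> t \<in> {0<..<T} \<Longrightarrow>
       norm (x t) \<le> \<beta>1 (norm (x 0) + c) (\<mu>1 t - \<mu>1 0)"
  proof (rule pt_certificate_bound[OF assms(10) order_refl \<open>T > 0\<close> rate], goal_cases)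
    case 1
    show ?case by (rule 1(1)[OF 1(2-4)])
  qed
  obtain \<beta>2 \<mu>2 where \<beta>2: "class_KL \<beta>2" and \<mu>2: "blow_up T \<mu>2"
    and bound2: "\<And>u x c m t. trajectory T f1 u \<Longrightarrow> trajectory T (\<lambda>y t. f2 y (u t) t) x \<Longrightarrow>
       c \<ge> 0 \<Longrightarrow> pt_exp_bound T 0 c (\<lambda>t. l * \<phi> t) (\<lambda>t. V2 (x t) t) \<Longrightarrow>
       (\<And>t. t \<in> {0..<T} \<Longrightarrow> norm (u t) \<le> m) \<Longrightarrow> t \<in> {0<..<T} \<Longrightarrow>
       norm (x t) \<le> \<beta>2 (norm (x 0) + m + c) (\<mu>2 t - \<mu>2 0)"
  proof (rule pt_certificate_input_bound[OF assms(11) order_refl \<open>T > 0\<close> rate, unfolded mem_Collect_eq], goal_cases)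
    case 1
    show ?case by (rule 1(1)[OF 1(2-4)])
  qed
  obtain \<alpha>1 where \<alpha>1: "class_K \<alpha>1" "\<And>x. V1 x 0 \<le> \<alpha>1 (norm x)"
    using class_K_majorant[OF assms(6,7)] by blast
  obtain \<alpha>2 where \<alpha>2: "class_K \<alpha>2" "\<And>x. V2 x 0 \<le> \<alpha>2 (norm x)"
    using class_K_majorant[OF assms(8,9)] by blast

  \<comment> \<open>With \<open>r\<close> the size of the initial state: \<gamma> bounds
    \<open>W\<close> at time 0 and is the signal constant \<open>c\<close> for both certificates;
    \<open>\<gamma>1\<close> bounds state plus constant for the first; \<open>m\<close> bounds the
    first component on all of [0,T), its summand \<open>r\<close> covering time 0;
    \<open>\<gamma>2\<close> bounds state plus input plus constant for the second.\<close>
  define \<gamma> where "\<gamma> r = \<alpha>2 r + k * \<alpha>1 r" for r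
  define \<gamma>1 where "\<gamma>1 r = r + \<gamma> r" for r
  define m where "m r = r + \<beta>1 (\<gamma>1 r) 0" for r
  define \<gamma>2 where "\<gamma>2 r = r + m r + \<gamma> r" for r
  have \<gamma>: "class_K \<gamma>"
    unfolding \<gamma>_def using k by (intro class_K_add class_K_scale \<alpha>1 \<alpha>2) simp
  have \<gamma>1: "class_K \<gamma>1"
    unfolding \<gamma>1_def by (intro class_K_add class_K_ident \<gamma>)
  have m: "class_K m"
    unfolding m_def using \<beta>1 by (intro class_K_add class_K_ident class_K_compose[OF _ \<gamma>1])
      (simp add: class_KL_def)
  have \<gamma>2: "class_K \<gamma>2"
    unfolding \<gamma>2_def by (intro class_K_add class_K_ident \<gamma> m)
  \<comment> \<open>At \<open>s = 1 / (T - t) - 1 / T\<close> the inner time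
    \<open>T - 1 / (s + 1 / T)\<close> is \<open>t\<close> again, so the first two summands become
    the certificate bounds in their own scales. The last one dominates the initial state at
    \<open>t = 0\<close>.\<close>
  define \<beta> where "\<beta> r s = \<beta>1 (\<gamma>1 r) (\<mu>1 (T - 1 / (s + 1 / T)) - \<mu>1 0) +
    \<beta>2 (\<gamma>2 r) (\<mu>2 (T - 1 / (s + 1 / T)) - \<mu>2 0) + r * exp (- s)" for r s
  have \<beta>: "class_KL \<beta>"
    unfolding \<beta>_def
    by (intro class_KL_add class_KL_exp class_KL_rescale \<beta>1 \<beta>2 \<mu>1 \<mu>2 \<gamma>1 \<gamma>2 \<open>T > 0\<close>)
  have mono: "\<beta>' r s \<le> \<beta>' r' s" if "class_KL \<beta>'" "s \<ge> 0" "0 \<le> r" "r \<le> r'" for \<beta>' r r' s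
    using that by (auto simp: class_KL_def intro: class_K_mono)

  have "norm (x t) \<le> \<beta> (norm (x 0)) (1 / (T - t) - 1 / (T - 0))"
    if x: "trajectory T (cascade f1 f2) x" and t: "t \<in> {0..<T}" for x t
  proof -
    let ?r = "norm (x 0)"
    have r: "norm (fst (x 0)) \<le> ?r" "norm (snd (x 0)) \<le> ?r"
      by (metis norm_fst_le norm_snd_le prod.collapse)+
    have \<gamma>r: "\<gamma> ?r \<ge> 0"
      by (simp add: class_K_nonneg[OF \<gamma>])
    define W where "W t = V2 (snd (x t)) t + k * V1 (fst (x t)) t" for t
    have "deriv_along_le T W (\<lambda>t. - (l * \<phi> t) * W t)"
      unfolding deriv_along_le_def
    proof
      fix t assume t: "t \<in> {0..<T}"
      obtain d1 d2 where d1: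
          "((\<lambda>t. V1 (fst (x t)) t) has_real_derivative d1) (at t within {0..<T})"
          "d1 \<le> - \<phi> t * V1 (fst (x t)) t"
        and d2: "((\<lambda>t. V2 (snd (x t)) t) has_real_derivative d2) (at t within {0..<T})"
          "d2 \<le> \<phi> t * (- a * V2 (snd (x t)) t + b * V1 (fst (x t)) t)"
        using assms(16,17)[OF x] t unfolding deriv_along_le_def by blast
      have "(W has_real_derivative d2 + k * d1) (at t within {0..<T})"
        unfolding W_def by (intro DERIV_add DERIV_cmult d1 d2)
      moreover have "d2 + k * d1 \<le> - (l * \<phi> t) * W t"
      proof -
        define v1 where "v1 = V1 (fst (x t)) t"
        define v2 where "v2 = V2 (snd (x t)) t"
        have v: "v1 \<ge> 0" "v2 \<ge> 0"
          unfolding v1_def v2_def using assms(4,5) t by auto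
        have "d2 + k * d1 \<le> \<phi> t * (- a * v2 + b * v1) + k * (- \<phi> t * v1)"
          unfolding v1_def v2_def using d1 d2 k by (intro add_mono mult_left_mono) auto
        \<comment> \<open>Splitting off the desired decay leaves a remainder whose coefficients
          \<open>a - l\<close> and \<open>k - (b + l * k)\<close> are nonnegative by the choice of
          \<open>l\<close> and \<open>k\<close>.\<close>
        also have "\<dots> = - (l * \<phi> t) * (v2 + k * v1) -
            \<phi> t * ((a - l) * v2 + (k - (b + l * k)) * v1)"
          by (simp add: algebra_simps)
        also have "\<dots> \<le> - (l * \<phi> t) * (v2 + k * v1)"
          using v l k \<phi>_pos[OF t] by simp
        finally show ?thesis by (simp add: W_def v1_def v2_def)
      qed
      ultimately show "\<exists>d. (W has_real_derivative d) (at t within {0..<T}) \<and> d \<le> - (l * \<phi> t) * W t"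
        by blast
    qed
    then have decay: "W t \<le> W 0 * exp (- integral {0..t} (\<lambda>t. l * \<phi> t))" if "t \<in> {0..<T}" for t
      using that blow_up_continuous[OF \<phi>] by (intro deriv_along_decay) (auto intro!: continuous_intros)
    have "V1 (fst (x 0)) 0 \<le> \<alpha>1 ?r" "V2 (snd (x 0)) 0 \<le> \<alpha>2 ?r"
      using \<alpha>1(2)[of "fst (x 0)"] \<alpha>2(2)[of "snd (x 0)"]
        class_K_mono[OF \<alpha>1(1) norm_ge_zero r(1)] class_K_mono[OF \<alpha>2(1) norm_ge_zero r(2)] by simp_all
    then have "W 0 \<le> \<gamma> ?r"
      unfolding W_def \<gamma>_def using k by (intro add_mono mult_left_mono) auto
    then have W: "W t \<le> \<gamma> ?r * exp (- integral {0..t} (\<lambda>t. l * \<phi> t))" if "t \<in> {0..<T}" for t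
      using decay[OF that] by (meson exp_ge_zero mult_right_mono order_trans)
    have le_W: "\<bar>V1 (fst (x t)) t\<bar> \<le> W t \<and> \<bar>V2 (snd (x t)) t\<bar> \<le> W t" if "t \<in> {0..<T}" for t
      using assms(4)[OF that, of "fst (x t)"] assms(5)[OF that, of "snd (x t)"] k
        mult_right_mono[of 1 k "V1 (fst (x t)) t"] by (simp add: W_def)
    have V: "pt_exp_bound T 0 (\<gamma> ?r) (\<lambda>t. l * \<phi> t) (\<lambda>t. V1 (fst (x t)) t)"
        "pt_exp_bound T 0 (\<gamma> ?r) (\<lambda>t. l * \<phi> t) (\<lambda>t. V2 (snd (x t)) t)"
      unfolding pt_exp_bound_def
      by (intro ballI order_trans[OF conjunct1[OF le_W] W] order_trans[OF conjunct2[OF le_W] W]; simp)+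
    note x12 = trajectory_cascade[OF x]
    have \<mu>_nonneg: "\<mu> t - \<mu> 0 \<ge> 0" if "blow_up T \<mu>" "t \<in> {0..<T}" for \<mu> t
      using blow_up_mono[OF that(1), of 0 t] that(2) by simp
    have x1: "norm (fst (x t)) \<le> \<beta>1 (\<gamma>1 ?r) (\<mu>1 t - \<mu>1 0)" if "t \<in> {0<..<T}" for t
    proof (rule order_trans[OF bound1[OF x12(1) \<gamma>r V(1) that]])
      show "\<beta>1 (norm (fst (x 0)) + \<gamma> ?r) (\<mu>1 t - \<mu>1 0) \<le> \<beta>1 (\<gamma>1 ?r) (\<mu>1 t - \<mu>1 0)"
        using that \<mu>_nonneg[OF \<mu>1, of t] r \<gamma>r by (intro mono[OF \<beta>1]) (auto simp: \<gamma>1_def)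
    qed
    have \<gamma>1r: "\<gamma>1 ?r \<ge> 0"
      by (simp add: class_K_nonneg[OF \<gamma>1])
    then have L: "class_L (\<beta>1 (\<gamma>1 ?r))"
      using \<beta>1 by (simp add: class_KL_def)
    \<comment> \<open>The input bound for the second certificate must be uniform in time and include
      \<open>t = 0\<close>. For positive times, monotonicity in the class L argument replaces the
      elapsed scale by 0.\<close>
    have x1_le: "norm (fst (x t)) \<le> m ?r" if "t \<in> {0..<T}" for t
    proof (cases "t = 0")
      case True
      have "\<beta>1 (\<gamma>1 ?r) 0 \<ge> 0" using L by (simp add: class_L_def)
      then show ?thesis using r True by (simp add: m_def)
    next
      case False
      then have "norm (fst (x t)) \<le> \<beta>1 (\<gamma>1 ?r) (\<mu>1 t - \<mu>1 0)"
        using x1[of t] that by simp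
      also have "\<dots> \<le> \<beta>1 (\<gamma>1 ?r) 0"
        using L \<mu>_nonneg[OF \<mu>1 that] by (auto simp: class_L_def monotone_on_def)
      finally show ?thesis by (simp add: m_def add_increasing)
    qed
    have x2: "norm (snd (x t)) \<le> \<beta>2 (\<gamma>2 ?r) (\<mu>2 t - \<mu>2 0)" if "t \<in> {0<..<T}" for t
    \<comment> \<open>The first component is a trajectory of \<open>f1\<close>, hence an admissible
      input, with bound \<open>m\<close> at the norm of the initial state.\<close>
    proof (rule order_trans[OF bound2[OF x12 \<gamma>r V(2) x1_le that]])
      show "\<beta>2 (norm (snd (x 0)) + m ?r + \<gamma> ?r) (\<mu>2 t - \<mu>2 0) \<le> \<beta>2 (\<gamma>2 ?r) (\<mu>2 t - \<mu>2 0)"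
        using that \<mu>_nonneg[OF \<mu>2, of t] r \<gamma>r class_K_nonneg[OF m, of ?r]
        by (intro mono[OF \<beta>2]) (auto simp: \<gamma>2_def)
    qed
    show ?thesis
    proof (cases "t = 0")
      case True
      have "\<beta>1 (\<gamma>1 ?r) 0 \<ge> 0" "\<beta>2 (\<gamma>2 ?r) 0 \<ge> 0"
        using \<beta>1 \<beta>2 \<gamma>1r class_K_nonneg[OF \<gamma>2, of ?r] by (auto simp: class_KL_def class_L_def)
      then show ?thesis
        using True by (simp add: \<beta>_def)
    next
      case False
      have "norm (x t) \<le> norm (fst (x t)) + norm (snd (x t))"
        using norm_Pair_le[of "fst (x t)" "snd (x t)"] by simp
      also have "\<dots> \<le> \<beta>1 (\<gamma>1 ?r) (\<mu>1 t - \<mu>1 0) + \<beta>2 (\<gamma>2 ?r) (\<mu>2 t - \<mu>2 0)"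
        using x1[of t] x2[of t] t False by auto
      \<comment> \<open>The rescaled times simplify to \<open>t\<close>, and the exponential summand
        is nonnegative.\<close>
      also have "\<dots> \<le> \<beta> ?r (1 / (T - t) - 1 / (T - 0))"
        by (simp add: \<beta>_def)
      finally show ?thesis .
    qed
  qed
  then show ?thesis
    unfolding pt_convergent_def using \<beta> blow_up_inverse[OF \<open>T > 0\<close>] by blast
qed

end
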